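(* Let $Y \in L^2(\Omega;\mathbb{R})$ and let $(Y_n)_{n \in \mathbb{N}_0} \subset L^2(\Omega;\mathbb{R})$ be such that $\lim_{n\to\infty} |\mathbb{E}[Y-Y_n]| = 0$. Then for all $n \in \mathbb{N}_0$ and $N \in \mathbb{N}$, the sampling error of approximating $|\mathbb{E}[Y-Y_n]|$ by $|\mathbb{E}[Y] - E_N[Y_n]|$ is bounded from below by \[ \big\| |\mathbb{E}[Y - Y_n]| - |\mathbb{E}[Y] - E_N[Y_n]| \big\|_{L^2(\Omega;\mathbb{R})} \ge -|\mathbb{E}[Y-Y_n]| + \left(|\mathbb{E}[Y-Y_n]|^2 + N^{-1} \mathrm{Var}[Y_n]\right)^{1/2} \] and from above by \[ \big\| |\mathbb{E}[Y - Y_n]| - |\mathbb{E}[Y] - E_N[Y_n]| \big\|_{L^2(\Omega;\mathbb{R})} \le N^{-1/2} (\mathrm{Var}[Y_n])^{1/2}. \]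
   Context: $(\Omega,\mathcal{A},P)$ is a probability space. $L^2(\Omega;\mathbb{R})$ is the space of real-valued random variables $Z$ with $\|Z\|_{L^2(\Omega;\mathbb{R})}^2 = \mathbb{E}[|Z|^2] < \infty$. For a real-valued random variable $Z$ and $N \in \mathbb{N}$, the Monte Carlo estimator is $E_N[Z] = N^{-1}\sum_{i=1}^N Z^{(i)}$, where $(Z^{(i)})_{i=1}^N$ is a sequence of independent, identically distributed random variables on $\Omega$ with the same law as $Z$. *)

theory Defs
  imports "HOL-Probability.Probability"
begin

definition L2_space :: "'a measure \<Rightarrow> ('a \<Rightarrow> real) set" where
  "L2_space M = {Z \<in> borel_measurable M. integrable M (\<lambda>\<omega>. \<bar>Z \<omega>\<bar>\<^sup>2)}"

text \<open>
  Since the Bochner integral of a non-integrable function is \<open>0\<close>, \<open>L2_norm M Z\<close> is the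
  \<open>L\<^sup>2\<close> norm of \<open>Z\<close> only if \<open>Z \<in> L2_space M\<close>.
\<close>

definition L2_norm :: "'a measure \<Rightarrow> ('a \<Rightarrow> real) \<Rightarrow> real" where
  "L2_norm M Z = sqrt (integral\<^sup>L M (\<lambda>\<omega>. \<bar>Z \<omega>\<bar>\<^sup>2))"

definition iid_sample ::
  "'a measure \<Rightarrow> ('a \<Rightarrow> real) \<Rightarrow> nat \<Rightarrow> (nat \<Rightarrow> 'a \<Rightarrow> real) \<Rightarrow> bool" where
  "iid_sample M Z N X \<longleftrightarrow>
     prob_space.indep_vars M (\<lambda>_. borel) X {1..N} \<and>
     (\<forall>i\<in>{1..N}. distr M borel (X i) = distr M borel Z)"

text \<open>
  The estimator depends on \<open>Z\<close> only through the sample \<open>X\<close> drawn from the law of \<open>Z\<close>, which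
  is therefore its argument.
\<close>

definition mc_estimator :: "nat \<Rightarrow> (nat \<Rightarrow> 'a \<Rightarrow> real) \<Rightarrow> 'a \<Rightarrow> real" where
  "mc_estimator N X \<omega> = (\<Sum>i=1..N. X i \<omega>) / real N"

end

theory Submission
  imports Defs
begin

text \<open>
  With \<open>W = E[Y] - E_N[Y_n]\<close> the statement concerns the distance between \<open>|E[W]|\<close> and
  \<open>|W|\<close>, where \<open>E[W] = E[Y - Y_n]\<close> and, by independence of the samples,
  \<open>Var[W] = Var[Y_n] / N\<close>. The upper bound is the reverse triangle inequality
  \<open>||E[W]| - |W|| \<le> |W - E[W]|\<close>. For the lower bound, expand the square and use
  \<open>E|W| \<le> (E[W^2])^(1/2)\<close>, where \<open>E[W^2] = |E[W]|^2 + Var[W]\<close>.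
\<close>

context prob_space
begin

lemma integrable_power2_add:
  fixes X Z :: "'a \<Rightarrow> real"
  assumes [measurable]: "random_variable borel X" "random_variable borel Z"
    and "integrable M (\<lambda>\<omega>. (X \<omega>)\<^sup>2)" "integrable M (\<lambda>\<omega>. (Z \<omega>)\<^sup>2)"
  shows "integrable M (\<lambda>\<omega>. (X \<omega> + Z \<omega>)\<^sup>2)"
proof (rule Bochner_Integration.integrable_bound)
  show "integrable M (\<lambda>\<omega>. 2 * (X \<omega>)\<^sup>2 + 2 * (Z \<omega>)\<^sup>2)"
    using assms by simp
  \<comment> \<open>The right side exceeds the left by exactly \<open>(x - z)^2\<close>.\<close>
  have "(x + z)\<^sup>2 \<le> 2 * x\<^sup>2 + 2 * z\<^sup>2" for x z :: real
    using zero_le_power2[of "x - z"] by (simp add: power2_sum power2_diff)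
  then show "AE \<omega> in M. norm ((X \<omega> + Z \<omega>)\<^sup>2) \<le> norm (2 * (X \<omega>)\<^sup>2 + 2 * (Z \<omega>)\<^sup>2)"
    by simp
qed simp

text \<open>Both bounds come from the single expansion E(b - |W|)^2 = b^2 - 2 b E|W| + E(W^2) and
  the chain b \<le> E|W| \<le> E(W^2)^(1/2). As b \<ge> 0, the right link bounds the error from
  below and the left link from above.\<close>

lemma abs_mean_minus_abs_bounds:
  fixes W :: "'a \<Rightarrow> real"
  assumes W[measurable]: "random_variable borel W" and sq: "integrable M (\<lambda>\<omega>. (W \<omega>)\<^sup>2)"
  defines "b \<equiv> \<bar>expectation W\<bar>"
  shows "integrable M (\<lambda>\<omega>. (b - \<bar>W \<omega>\<bar>)\<^sup>2)"
    and "sqrt (b\<^sup>2 + variance W) - b \<le> sqrt (expectation (\<lambda>\<omega>. (b - \<bar>W \<omega>\<bar>)\<^sup>2))"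
    and "sqrt (expectation (\<lambda>\<omega>. (b - \<bar>W \<omega>\<bar>)\<^sup>2)) \<le> sqrt (variance W)"
proof -
  have int: "integrable M W"
    using square_integrable_imp_integrable[OF W sq] .
  let ?s = "sqrt (expectation (\<lambda>\<omega>. (W \<omega>)\<^sup>2))"
  have b2: "b\<^sup>2 = (expectation W)\<^sup>2"
    by (simp add: b_def)
  have var: "variance W = expectation (\<lambda>\<omega>. (W \<omega>)\<^sup>2) - b\<^sup>2"
    using variance_eq[OF int sq] b2 by simp
  have expand: "(b - \<bar>W \<omega>\<bar>)\<^sup>2 = b\<^sup>2 - 2 * b * \<bar>W \<omega>\<bar> + (W \<omega>)\<^sup>2" for \<omega>
    by (simp add: power2_diff)
  show interr: "integrable M (\<lambda>\<omega>. (b - \<bar>W \<omega>\<bar>)\<^sup>2)"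
    unfolding expand using int sq by simp
  have E: "expectation (\<lambda>\<omega>. (b - \<bar>W \<omega>\<bar>)\<^sup>2)
      = b\<^sup>2 - 2 * b * expectation (\<lambda>\<omega>. \<bar>W \<omega>\<bar>) + expectation (\<lambda>\<omega>. (W \<omega>)\<^sup>2)"
    unfolding expand using int sq by (simp add: prob_space)
  \<comment> \<open>Jensen's inequality E|W| \<le> E(W^2)^(1/2), read off from the variance of
    |W|.\<close>
  have "0 \<le> variance (\<lambda>\<omega>. \<bar>W \<omega>\<bar>)"
    by (rule variance_positive)
  also have "\<dots> = expectation (\<lambda>\<omega>. (W \<omega>)\<^sup>2) - (expectation (\<lambda>\<omega>. \<bar>W \<omega>\<bar>))\<^sup>2"
    using variance_eq[of "\<lambda>\<omega>. \<bar>W \<omega>\<bar>"] int sq by simp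
  finally have "expectation (\<lambda>\<omega>. \<bar>W \<omega>\<bar>) \<le> ?s"
    by (intro real_le_rsqrt) simp
  then have "2 * b * expectation (\<lambda>\<omega>. \<bar>W \<omega>\<bar>) \<le> 2 * b * ?s"
    by (intro mult_left_mono) (auto simp: b_def)
  \<comment> \<open>Since \<open>b^2 + variance W\<close> is E(W^2), the claimed lower bound is
    \<open>?s - b\<close>; replacing E|W| by \<open>?s\<close> in the expansion yields its
    square.\<close>
  moreover have "(?s - b)\<^sup>2 = b\<^sup>2 - 2 * b * ?s + expectation (\<lambda>\<omega>. (W \<omega>)\<^sup>2)"
    by (simp add: power2_diff)
  ultimately have "(?s - b)\<^sup>2 \<le> expectation (\<lambda>\<omega>. (b - \<bar>W \<omega>\<bar>)\<^sup>2)"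
    using E by linarith
  then show "sqrt (b\<^sup>2 + variance W) - b \<le> sqrt (expectation (\<lambda>\<omega>. (b - \<bar>W \<omega>\<bar>)\<^sup>2))"
    unfolding var by (intro real_le_rsqrt) simp
  have "b \<le> expectation (\<lambda>\<omega>. \<bar>W \<omega>\<bar>)"
    unfolding b_def using integral_norm_bound[of M W] by simp
  \<comment> \<open>This bounds the expansion by b^2 - 2 b^2 + E(W^2), which is the variance of
    W.\<close>
  then have "b * b \<le> b * expectation (\<lambda>\<omega>. \<bar>W \<omega>\<bar>)"
    by (intro mult_left_mono) (auto simp: b_def)
  then show "sqrt (expectation (\<lambda>\<omega>. (b - \<bar>W \<omega>\<bar>)\<^sup>2)) \<le> sqrt (variance W)"
    unfolding E var by (simp add: power2_eq_square)
qed

text \<open>Pythagoras: centred independent variables are orthogonal in L2. Integrability goes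
  through the same induction, since the partial sum must be integrable before the expectation of its
  product with the next term can be factored.\<close>

lemma expectation_power2_sum_indep_vars:
  fixes Z :: "'i \<Rightarrow> 'a \<Rightarrow> real"
  assumes "finite I" and "indep_vars (\<lambda>_. borel) Z I"
    and "\<And>i. i \<in> I \<Longrightarrow> integrable M (\<lambda>\<omega>. (Z i \<omega>)\<^sup>2)"
    and "\<And>i. i \<in> I \<Longrightarrow> expectation (Z i) = 0"
  shows "integrable M (\<lambda>\<omega>. (\<Sum>i\<in>I. Z i \<omega>)\<^sup>2)"
    and "expectation (\<lambda>\<omega>. (\<Sum>i\<in>I. Z i \<omega>)\<^sup>2) = (\<Sum>i\<in>I. expectation (\<lambda>\<omega>. (Z i \<omega>)\<^sup>2))"
proof -
  have "integrable M (\<lambda>\<omega>. (\<Sum>i\<in>I. Z i \<omega>)\<^sup>2) \<and>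
      expectation (\<lambda>\<omega>. (\<Sum>i\<in>I. Z i \<omega>)\<^sup>2) = (\<Sum>i\<in>I. expectation (\<lambda>\<omega>. (Z i \<omega>)\<^sup>2))"
    using assms
  proof (induction I rule: finite_induct)
    case empty
    then show ?case by simp
  next
    case (insert j I)
    let ?S = "\<lambda>\<omega>. \<Sum>i\<in>I. Z i \<omega>"
    have rv[measurable]: "random_variable borel (Z i)" if "i \<in> insert j I" for i
      using insert.prems(1) that by (auto simp: indep_vars_def)
    have S[measurable]: "random_variable borel ?S"
      by (intro borel_measurable_sum rv) simp
    have "indep_vars (\<lambda>_. borel) Z I"
      using insert.prems(1) by (rule indep_vars_subset) auto
    with insert have S2: "integrable M (\<lambda>\<omega>. (?S \<omega>)\<^sup>2)"
      and ES2: "expectation (\<lambda>\<omega>. (?S \<omega>)\<^sup>2) = (\<Sum>i\<in>I. expectation (\<lambda>\<omega>. (Z i \<omega>)\<^sup>2))"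
      by auto
    have Z2: "integrable M (\<lambda>\<omega>. (Z j \<omega>)\<^sup>2)"
      using insert.prems by simp
    have iZ: "integrable M (Z j)" and iS: "integrable M ?S"
      using square_integrable_imp_integrable Z2 S2 S rv by blast+
    \<comment> \<open>The new term is independent of the sum of the others, so the cross term
      factors and vanishes because \<open>Z j\<close> has mean 0.\<close>
    have ind: "indep_var borel (Z j) borel ?S"
      using insert by (intro indep_vars_sum) auto
    have prod: "integrable M (\<lambda>\<omega>. Z j \<omega> * ?S \<omega>)" "expectation (\<lambda>\<omega>. Z j \<omega> * ?S \<omega>) = 0"
      using indep_var_integrable[OF ind iZ iS] indep_var_lebesgue_integral[OF ind iZ iS]
        insert.prems(3)[of j] by auto
    have "(\<Sum>i\<in>insert j I. Z i \<omega>)\<^sup>2 = (Z j \<omega>)\<^sup>2 + (?S \<omega>)\<^sup>2 + 2 * (Z j \<omega> * ?S \<omega>)" for \<omega>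
      using insert.hyps by (simp add: power2_sum)
    then show ?case
      using prod Z2 S2 ES2 insert.hyps by simp
  qed
  then show "integrable M (\<lambda>\<omega>. (\<Sum>i\<in>I. Z i \<omega>)\<^sup>2)"
    and "expectation (\<lambda>\<omega>. (\<Sum>i\<in>I. Z i \<omega>)\<^sup>2) = (\<Sum>i\<in>I. expectation (\<lambda>\<omega>. (Z i \<omega>)\<^sup>2))"
    by auto
qed

text \<open>The mean follows by linearity. For the variance, Pythagoras is applied to the centred
  samples: N equal contributions, divided by N^2.\<close>

lemma mc_estimator_moments:
  fixes Z :: "'a \<Rightarrow> real"
  assumes Z[measurable]: "random_variable borel Z" and sq: "integrable M (\<lambda>\<omega>. (Z \<omega>)\<^sup>2)"
    and "N \<ge> 1" and iid: "iid_sample M Z N X"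
  shows "random_variable borel (mc_estimator N X)"
    and "integrable M (\<lambda>\<omega>. (mc_estimator N X \<omega>)\<^sup>2)"
    and "expectation (mc_estimator N X) = expectation Z"
    and "variance (mc_estimator N X) = variance Z / real N"
proof -
  let ?\<mu> = "expectation Z" and ?E = "mc_estimator N X"
  have ind: "indep_vars (\<lambda>_. borel) X {1..N}"
    and law: "\<And>i. i \<in> {1..N} \<Longrightarrow> distr M borel (X i) = distr M borel Z"
    using iid by (auto simp: iid_sample_def)
  have rv[measurable]: "random_variable borel (X i)" if "i \<in> {1..N}" for i
    using ind that by (auto simp: indep_vars_def)
  \<comment> \<open>Both sides depend only on the common law. It is used below for the identity and
    for the squared deviation from \<open>?\<mu>\<close>.\<close>
  have transfer: "integrable M (\<lambda>\<omega>. f (X i \<omega>)) \<longleftrightarrow> integrable M (\<lambda>\<omega>. f (Z \<omega>))"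
      "expectation (\<lambda>\<omega>. f (X i \<omega>)) = expectation (\<lambda>\<omega>. f (Z \<omega>))"
    if "i \<in> {1..N}" and [measurable]: "f \<in> borel_measurable borel"
    for i and f :: "real \<Rightarrow> real"
    using that law[OF that(1)] rv[OF that(1)] Z
    by (metis integrable_distr_eq, metis integral_distr)
  have iZ: "integrable M Z"
    using square_integrable_imp_integrable[OF Z sq] .
  have iX: "integrable M (X i)" and EX: "expectation (X i) = ?\<mu>" if "i \<in> {1..N}" for i
    using transfer[OF that, of "\<lambda>x. x"] iZ by auto
  have "integrable M (\<lambda>\<omega>. (Z \<omega> - ?\<mu>)\<^sup>2)"
    using sq iZ by (simp add: power2_diff)
  then have c2: "integrable M (\<lambda>\<omega>. (X i \<omega> - ?\<mu>)\<^sup>2)"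
    and Ec2: "expectation (\<lambda>\<omega>. (X i \<omega> - ?\<mu>)\<^sup>2) = variance Z" if "i \<in> {1..N}" for i
    using transfer[OF that, of "\<lambda>x. (x - ?\<mu>)\<^sup>2"] by auto
  have c0: "expectation (\<lambda>\<omega>. X i \<omega> - ?\<mu>) = 0" if "i \<in> {1..N}" for i
    using iX[OF that] EX[OF that] by (simp add: prob_space)
  have indc: "indep_vars (\<lambda>_. borel) (\<lambda>i \<omega>. X i \<omega> - ?\<mu>) {1..N}"
    using ind by (rule indep_vars_compose2) simp
  note S = expectation_power2_sum_indep_vars[OF finite_atLeastAtMost indc c2 c0]
  \<comment> \<open>Here \<open>N \<ge> 1\<close> ensures that the N copies of \<open>?\<mu>\<close>
    average to \<open>?\<mu>\<close>; division by 0 would give 0.\<close>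
  have centre: "?E \<omega> - ?\<mu> = (\<Sum>i=1..N. X i \<omega> - ?\<mu>) / real N" for \<omega>
    using \<open>N \<ge> 1\<close> by (simp add: mc_estimator_def sum_subtractf diff_divide_distrib)
  show E[measurable]: "random_variable borel ?E"
    unfolding mc_estimator_def
    by (intro borel_measurable_divide borel_measurable_sum rv) auto
  show mean: "expectation ?E = ?\<mu>"
    unfolding mc_estimator_def using iX EX \<open>N \<ge> 1\<close> by simp
  have cint: "integrable M (\<lambda>\<omega>. (?E \<omega> - ?\<mu>)\<^sup>2)"
    unfolding centre power_divide using S(1) by simp
  then have "integrable M (\<lambda>\<omega>. ((?E \<omega> - ?\<mu>) + ?\<mu>)\<^sup>2)"
    by (intro integrable_power2_add) auto
  then show "integrable M (\<lambda>\<omega>. (?E \<omega>)\<^sup>2)"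
    by simp
  have "variance ?E = (\<Sum>i=1..N. variance Z) / (real N)\<^sup>2"
    unfolding mean centre power_divide using S(2) Ec2 by simp
  then show "variance ?E = variance Z / real N"
    by (simp add: power2_eq_square)
qed

end

text \<open>The bounds hold for every iid sample \<open>X\<close>. Membership of \<open>err\<close>
  in \<open>L2_space M\<close> is part of the claim because only then is
  \<open>L2_norm M err\<close> a genuine norm rather than a default value of the integral.\<close>

theorem proposition2p2:
  fixes M :: "'a measure"
    and Y :: "'a \<Rightarrow> real"
    and Yn :: "nat \<Rightarrow> 'a \<Rightarrow> real"
  assumes "prob_space M"
    and "Y \<in> L2_space M"
    and "\<And>n. Yn n \<in> L2_space M"
    and "(\<lambda>n. \<bar>prob_space.expectation M (\<lambda>\<omega>. Y \<omega> - Yn n \<omega>)\<bar>) \<longlonglongrightarrow> 0"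
  shows "\<forall>n N X. N \<ge> 1 \<longrightarrow> iid_sample M (Yn n) N X \<longrightarrow>
    (let bias = \<bar>prob_space.expectation M (\<lambda>\<omega>. Y \<omega> - Yn n \<omega>)\<bar>;
         err = (\<lambda>\<omega>. bias - \<bar>prob_space.expectation M Y - mc_estimator N X \<omega>\<bar>)
     in err \<in> L2_space M
        \<and> L2_norm M err \<ge> - bias + sqrt (bias\<^sup>2 + prob_space.variance M (Yn n) / real N)
        \<and> L2_norm M err \<le> sqrt (prob_space.variance M (Yn n)) / sqrt (real N))"
proof (intro allI impI)
  fix n N :: nat and X :: "nat \<Rightarrow> 'a \<Rightarrow> real"
  assume N: "N \<ge> 1" and iid: "iid_sample M (Yn n) N X"
  interpret prob_space M by fact
  let ?W = "\<lambda>\<omega>. expectation Y - mc_estimator N X \<omega>"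
  have Y: "random_variable borel Y" "integrable M (\<lambda>\<omega>. (Y \<omega>)\<^sup>2)"
    and Yn: "random_variable borel (Yn n)" "integrable M (\<lambda>\<omega>. (Yn n \<omega>)\<^sup>2)"
    using assms(2) assms(3)[of n] by (auto simp: L2_space_def)
  note mc = mc_estimator_moments[OF Yn N iid]
  note [measurable] = mc(1)
  have ints: "integrable M Y" "integrable M (Yn n)" "integrable M (mc_estimator N X)"
    using square_integrable_imp_integrable Y Yn mc(1,2) by blast+
  have W: "random_variable borel ?W"
    by simp
  have W2: "integrable M (\<lambda>\<omega>. (?W \<omega>)\<^sup>2)"
    using mc(2) ints(3) by (simp add: power2_diff)
  \<comment> \<open>Unbiasedness of the estimator turns the bias into the mean of
    \<open>?W\<close>.\<close>
  have mean: "expectation ?W = expectation (\<lambda>\<omega>. Y \<omega> - Yn n \<omega>)"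
    using ints mc(3) by (simp add: prob_space)
  have "variance ?W = variance (mc_estimator N X)"
    using ints(3) by (simp add: prob_space power2_commute)
  then have var: "variance ?W = variance (Yn n) / real N"
    using mc(4) by simp
  show "let bias = \<bar>expectation (\<lambda>\<omega>. Y \<omega> - Yn n \<omega>)\<bar>;
         err = (\<lambda>\<omega>. bias - \<bar>expectation Y - mc_estimator N X \<omega>\<bar>)
     in err \<in> L2_space M
        \<and> L2_norm M err \<ge> - bias + sqrt (bias\<^sup>2 + variance (Yn n) / real N)
        \<and> L2_norm M err \<le> sqrt (variance (Yn n)) / sqrt (real N)"
    \<comment> \<open>The order matters: \<open>variance ?W\<close> contains
      \<open>expectation ?W\<close>, so \<open>var\<close> has to be rewritten before
      \<open>mean\<close>.\<close>
    using abs_mean_minus_abs_bounds[OF W W2, unfolded var, unfolded mean]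
    by (simp add: Let_def L2_space_def L2_norm_def real_sqrt_divide)
qed

end
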